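(* Let $\Lambda=\{\lambda_j\}_{j\ge1}$ and $\Gamma=\{\gamma_j\}_{j\ge1}$ be Waterman sequences, let $\{q_n\}_{n\ge1}$ be a sequence of real numbers with $1\le q_n\uparrow q\le\infty$, let $\{\delta_n\}_{n\ge1}$ be a sequence of real numbers with $2\le\delta_n\uparrow\infty$, and let $1\le p<\infty$. (1) If $p\le q_n$ for all $n$, then the embedding $\Lambda\mathrm{BV}^{(p)}\subseteq\Gamma\mathrm{BV}^{(q_n\uparrow q)}$ holds if and only if $$\limsup_{n\to\infty}\ \max_{1\le k\le\delta_n}\Gamma(k)^{\frac1{q_n}}\,\Lambda(k)^{-\frac1p}<\infty ,$$ where the maximum is over integers $k$. (2) The same equivalence holds if the hypothesis that $p\le q_n$ for all $n$ is replaced by the hypothesis that the sequence $\{\Gamma(n)/\Lambda(n)\}_{n=1}^\infty$ is nondecreasing.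
   Context: A Waterman sequence is a nondecreasing sequence $\Lambda=\{\lambda_j\}_{j=1}^\infty$ of positive numbers with $\sum_{j=1}^\infty 1/\lambda_j=\infty$. Its associated function is $\Lambda(r):=\sum_{j=1}^{[r]}1/\lambda_j$ for real $r\ge1$ ($[r]$ is the integer part); similarly $\Gamma(r):=\sum_{j=1}^{[r]}1/\gamma_j$. The notation $q_n\uparrow q$ means that $\{q_n\}$ is nondecreasing (possibly constant) with limit $q$; $\delta_n\uparrow\infty$ means nondecreasing with limit $\infty$. All functions are real-valued on $[0,1]$. For an interval $I\subseteq[0,1]$, $f(I):=f(\sup I)-f(\inf I)$ and $|I|$ is its length. For $1\le p<\infty$, $\Lambda\mathrm{BV}^{(p)}$ (the Waterman-Shiba class) is the set of all $f$ such that $\sup\sum_{j=1}^s |f(I_j)|^p/\lambda_j<\infty$, the supremum being over all finite (ordered) collections $\{I_j\}_{j=1}^s$ of nonoverlapping subintervals of $[0,1]$. $\Gamma\mathrm{BV}^{(q_n\uparrow q)}$ $(=\Gamma\mathrm{BV}_\delta^{(q_n\uparrow q)})$ is the set of all $f$ such that $$\sup_{n\ge1}\ \sup_{\{I_j\}}\Big(\sum_{j=1}^s\frac{|f(I_j)|^{q_n}}{\gamma_j}\Big)^{1/q_n}<\infty,$$ where, for each $n$, the inner supremum is over all finite collections $\{I_j\}_{j=1}^s$ of nonoverlapping subintervals of $[0,1]$ with $\inf_j|I_j|\ge 1/\delta_n$. *)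

theory Defs
  imports "HOL-Analysis.Analysis"
begin

text \<open>All sequences are indexed from 1; their value at index 0 is never used.\<close>

definition waterman_seq :: "(nat \<Rightarrow> real) \<Rightarrow> bool" where
  "waterman_seq lam \<longleftrightarrow>
     (\<forall>j\<ge>1. 0 < lam j) \<and> mono_on {1..} lam \<and>
     filterlim (\<lambda>n. \<Sum>j=1..n. 1 / lam j) at_top sequentially"

definition assoc_fun :: "(nat \<Rightarrow> real) \<Rightarrow> real \<Rightarrow> real" where
  "assoc_fun lam r = (\<Sum>j=1..nat \<lfloor>r\<rfloor>. 1 / lam j)"

definition increment :: "(real \<Rightarrow> real) \<Rightarrow> real set \<Rightarrow> real" where
  "increment f I = f (Sup I) - f (Inf I)"

definition interval_length :: "real set \<Rightarrow> real" where
  "interval_length I = Sup I - Inf I"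

text \<open>
  A finite ordered collection \<open>I 1, \<dots>, I s\<close> of nonoverlapping subintervals of \<open>[0,1]\<close>: open,
  closed and half-open intervals are all admitted, and nonoverlapping means having no common
  interior point. One-point intervals are admitted too; their increments vanish.
\<close>
definition nonoverlapping_intervals :: "nat \<Rightarrow> (nat \<Rightarrow> real set) \<Rightarrow> bool" where
  "nonoverlapping_intervals s I \<longleftrightarrow>
     (\<forall>j\<in>{1..s}. is_interval (I j) \<and> I j \<noteq> {} \<and> I j \<subseteq> {0..1}) \<and>
     (\<forall>i\<in>{1..s}. \<forall>j\<in>{1..s}. i \<noteq> j \<longrightarrow> interior (I i) \<inter> interior (I j) = {})"

text \<open>
  A function on \<open>[0,1]\<close> is represented by a total function on the reals. Membership in the two
  classes below depends only on its values on \<open>[0,1]\<close>, so inclusions between them are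
  inclusions between the corresponding classes of functions on \<open>[0,1]\<close>.
\<close>

definition waterman_shiba :: "(nat \<Rightarrow> real) \<Rightarrow> real \<Rightarrow> (real \<Rightarrow> real) set" where
  "waterman_shiba lam p =
     {f. (SUP (s, I) \<in> {(s, I). nonoverlapping_intervals s I}.
            ereal (\<Sum>j=1..s. \<bar>increment f (I j)\<bar> powr p / lam j)) < \<infinity>}"

definition gamma_BV ::
    "(nat \<Rightarrow> real) \<Rightarrow> (nat \<Rightarrow> real) \<Rightarrow> (nat \<Rightarrow> real) \<Rightarrow> (real \<Rightarrow> real) set" where
  "gamma_BV gam q \<delta> =
     {f. (SUP n \<in> {1..}.
            SUP (s, I) \<in> {(s, I). nonoverlapping_intervals s I \<and>
                                 (\<forall>j\<in>{1..s}. interval_length (I j) \<ge> 1 / \<delta> n)}.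
              ereal ((\<Sum>j=1..s. \<bar>increment f (I j)\<bar> powr q n / gam j) powr (1 / q n))) < \<infinity>}"

end

theory Submission
  imports Defs
begin

text \<open>
  Write \<open>\<Lambda>(k)\<close> and \<open>\<Gamma>(k)\<close> for the partial sums of \<open>1 / lam j\<close> and \<open>1 / gam j\<close>. The limit superior is
  finite exactly when one constant \<open>C\<close> satisfies \<open>\<Gamma>(k) powr (1 / q n) \<le> C * \<Lambda>(k) powr (1 / p)\<close>
  for all \<open>n\<close> and all \<open>k \<le> \<delta> n\<close>, because each single maximum is finite
  (\<open>limsup_Max_less_PInf_iff\<close>).

  Such a bound gives the embedding. At level \<open>n\<close> only intervals of length at least \<open>1 / \<delta> n\<close>
  compete, so there are at most \<open>\<delta> n\<close> of them. Numbering them by decreasing size of the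
  increment can only increase the \<open>\<Gamma>\<close>-sum, and the \<open>\<Lambda>\<close>-sum stays below the variation of the
  function whatever the numbering. For decreasing sequences the bound on the partial sums says
  that the inequality between the two weighted norms holds for the indicator of every initial
  segment \<open>{1..k}\<close>; every nonnegative decreasing sequence is a nonnegative combination of such indicators. For \<open>p \<le> q n\<close>
  the inequality passes from them to every decreasing sequence by convexity. For \<open>q n < p\<close>
  convexity fails, and the monotonicity of \<open>\<Gamma> / \<Lambda>\<close> replaces it: it allows \<open>\<Gamma>\<close> to be exchanged
  for \<open>\<Lambda>\<close> at the exponent \<open>p\<close>, and Jensen's inequality lowers the exponent to \<open>q n\<close>. Both cases are
  \<open>weighted_norm_le_of_partial_sums_le\<close>.

  Conversely, if there is no bound, choose levels \<open>N i\<close> and numbers \<open>r i \<le> \<delta> (N i)\<close> at which the ratio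
  exceeds \<open>4 ^ i\<close>. A single function has, for each \<open>i\<close>, about \<open>r i / 2\<close> needles, spread evenly
  over \<open>[0,1]\<close>, whose heights have \<open>p\<close>-th power at least \<open>1 / (2 ^ i * \<Lambda>(r i))\<close>. The needles
  of family \<open>i\<close> contribute at most a multiple of \<open>1 / 2 ^ i\<close> to the \<open>\<Lambda>\<close>-variation, so the function
  lies in the Waterman-Shiba class; at level \<open>N i\<close> they force a variation of at least
  \<open>2 ^ i / 3\<close>. To avoid any interaction between the families, it is the \<open>p\<close>-th powers of the
  heights that are added up, and the needles stand at irrational points, so that the function
  vanishes at all rational ones.
\<close>

section \<open>Decreasing sequences and rearrangement\<close>

text \<open>
  Summation by parts writes \<open>y\<close> as a nonnegative combination of indicators of initial segments
  \<open>{1..k}\<close>, for which the inequality is the hypothesis on partial sums. The induction carries the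
  boundary term of the summation by parts: the difference of the two sums up to \<open>k\<close> is at least
  \<open>y k\<close> times the difference of the partial sums.
\<close>

lemma sum_le_sum_of_partial_sums_le:
  fixes y u v :: "nat \<Rightarrow> real"
  assumes y: "antimono_on {1..s} y" "\<And>j. j \<in> {1..s} \<Longrightarrow> 0 \<le> y j"
    and uv: "\<And>k. k \<in> {1..s} \<Longrightarrow> (\<Sum>j=1..k. u j) \<le> (\<Sum>j=1..k. v j)"
  shows "(\<Sum>j=1..s. y j * u j) \<le> (\<Sum>j=1..s. y j * v j)"
proof (cases "s = 0")
  case False
  define D where "D k = (\<Sum>j=1..k. v j - u j)" for k
  have D: "0 \<le> D k" if "k \<in> {1..s}" for k
    using uv[OF that] by (simp add: D_def sum_subtractf)
  have "k \<le> s \<longrightarrow> y k * D k \<le> (\<Sum>j=1..k. y j * (v j - u j))" if "1 \<le> k" for k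
    using that
  proof (induction k rule: dec_induct)
    case base
    show ?case by (simp add: D_def)
  next
    case (step k)
    show ?case
    proof
      assume k: "Suc k \<le> s"
      have "y (Suc k) * D k \<le> y k * D k"
        using k step.hyps D[of k] by (intro mult_right_mono monotone_onD[OF y(1)]) auto
      with step k show "y (Suc k) * D (Suc k) \<le> (\<Sum>j=1..Suc k. y j * (v j - u j))"
        by (auto simp: D_def algebra_simps)
    qed
  qed
  from this[of s] False have "y s * D s \<le> (\<Sum>j=1..s. y j * (v j - u j))"
    by simp
  moreover have "0 \<le> y s * D s"
    using False y(2)[of s] D[of s] by simp
  ultimately show ?thesis
    by (simp add: right_diff_distrib sum_subtractf)
qed simp

text \<open>
  The largest element of a set of \<open>n\<close> positive integers is at least \<open>n\<close>, so a decreasing weight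
  there is at most \<open>w n\<close>; remove it and continue.
\<close>

lemma sum_le_sum_initial_segment:
  fixes w :: "nat \<Rightarrow> real"
  assumes w: "antimono_on {1..} w" and "finite A" "A \<subseteq> {1..}"
  shows "sum w A \<le> (\<Sum>j=1..card A. w j)"
  using assms(2,3)
proof (induction A rule: finite_linorder_max_induct)
  case (insert b A)
  have "insert b A \<subseteq> {1..b}"
    using insert.hyps insert.prems by (auto simp: less_imp_le)
  then have "card (insert b A) \<le> b"
    using card_mono[of "{1..b}" "insert b A"] by simp
  then have "Suc (card A) \<le> b"
    using insert.hyps by (metis card_insert_disjoint less_irrefl)
  then have "w b \<le> w (Suc (card A))"
    by (intro monotone_onD[OF w]) auto
  then show ?case
    using insert by (auto simp: less_irrefl)
qed simp

lemma ex_decreasing_arrangement: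
  fixes b :: "nat \<Rightarrow> real"
  obtains \<pi> where "bij_betw \<pi> {1..s} {1..s}" "antimono_on {1..s} (b \<circ> \<pi>)"
proof -
  define xs where "xs = sort_key (\<lambda>j. - b j) [1..<Suc s]"
  have len: "length xs = s" and set: "set xs = {1..s}" and dist: "distinct xs"
    and sorted: "sorted (map (\<lambda>j. - b j) xs)"
    by (auto simp: xs_def)
  have "bij_betw (\<lambda>j. xs ! (j - 1)) {1..s} {1..s}"
  proof -
    have "bij_betw (\<lambda>j. j - 1) {1..s} {..<s}"
      by (rule bij_betw_byWitness[where f' = Suc]) auto
    moreover have "bij_betw ((!) xs) {..<s} {1..s}"
      using bij_betw_nth[OF dist, of "{..<s}" "{1..s}"] len set by simp
    ultimately show ?thesis
      using bij_betw_trans by (fastforce simp: comp_def)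
  qed
  moreover have "antimono_on {1..s} (b \<circ> (\<lambda>j. xs ! (j - 1)))"
  proof (rule monotone_onI)
    fix i j assume "i \<in> {1..s}" "j \<in> {1..s}" "i \<le> j"
    then show "(b \<circ> (\<lambda>j. xs ! (j - 1))) j \<le> (b \<circ> (\<lambda>j. xs ! (j - 1))) i"
      using sorted_nth_mono[OF sorted, of "i - 1" "j - 1"] len by auto
  qed
  ultimately show ?thesis using that by blast
qed

text \<open>
  Summation in the order of \<open>\<pi>\<close> turns the left-hand side into a sum with the decreasing factor
  \<open>b \<circ> \<pi>\<close> and permuted weights. Among all sets of \<open>k\<close> indices the initial segment carries the
  largest weight, so restoring the order of the weights increases all partial sums.
\<close>

lemma sum_mult_le_sum_decreasing_arrangement:
  fixes b w :: "nat \<Rightarrow> real"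
  assumes w: "antimono_on {1..} w"
    and \<pi>: "bij_betw \<pi> {1..s} {1..s}" "antimono_on {1..s} (b \<circ> \<pi>)"
    and b: "\<And>j. j \<in> {1..s} \<Longrightarrow> 0 \<le> b j"
  shows "(\<Sum>j=1..s. b j * w j) \<le> (\<Sum>j=1..s. b (\<pi> j) * w j)"
proof -
  have "(\<Sum>j=1..s. b j * w j) = (\<Sum>j=1..s. (b \<circ> \<pi>) j * w (\<pi> j))"
    using sum.reindex_bij_betw[OF \<pi>(1), of "\<lambda>j. b j * w j"] by simp
  also have "\<dots> \<le> (\<Sum>j=1..s. (b \<circ> \<pi>) j * w j)"
  proof (rule sum_le_sum_of_partial_sums_le[OF \<pi>(2)])
    show "0 \<le> (b \<circ> \<pi>) j" if "j \<in> {1..s}" for j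
      using b bij_betwE[OF \<pi>(1)] that by auto
    fix k assume k: "k \<in> {1..s}"
    have inj: "inj_on \<pi> {1..k}"
      using \<pi>(1) k by (auto simp: bij_betw_def intro: inj_on_subset)
    have "\<pi> ` {1..k} \<subseteq> {1..}"
      using bij_betwE[OF \<pi>(1)] k by fastforce
    then have "sum w (\<pi> ` {1..k}) \<le> (\<Sum>j=1..card (\<pi> ` {1..k}). w j)"
      by (intro sum_le_sum_initial_segment[OF w]) auto
    then show "(\<Sum>j=1..k. w (\<pi> j)) \<le> (\<Sum>j=1..k. w j)"
      unfolding sum.reindex[OF inj] card_image[OF inj] by (simp add: comp_def)
  qed
  finally show ?thesis by simp
qed


section \<open>Weighted norms of decreasing sequences\<close>

lemma powr_add_le_add_powr:
  fixes s h r :: real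
  assumes "0 \<le> s" "0 \<le> h" "1 \<le> r"
  shows "s powr r + h powr r \<le> (s + h) powr r"
proof -
  have *: "a powr r \<le> a * (s + h) powr (r - 1)" if "0 \<le> a" "a \<le> s + h" for a
  proof (cases "a = 0")
    case False
    then have "a powr r = a * a powr (r - 1)"
      using that by (simp add: powr_diff)
    then show ?thesis
      using that assms by (simp add: mult_left_mono powr_mono2)
  qed simp
  have "s powr r + h powr r \<le> (s + h) * (s + h) powr (r - 1)"
    using *[of s] *[of h] assms by (simp add: distrib_right)
  also have "\<dots> \<le> (s + h) powr r"
    using assms by (cases "s + h = 0") (simp_all add: powr_diff)
  finally show ?thesis .
qed

text \<open>
  The convexity inequality for \<open>t + h\<close> and \<open>s\<close>, two points of the interval from \<open>t\<close> to \<open>s + h\<close> with the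
  same sum as its endpoints. For \<open>t = 0\<close> it is the superadditivity above.
\<close>

lemma powr_increment_mono:
  fixes s t h r :: real
  assumes "0 \<le> t" "t \<le> s" "0 \<le> h" "1 \<le> r"
  shows "(t + h) powr r - t powr r \<le> (s + h) powr r - s powr r"
proof -
  consider "t = 0" | "h = 0 \<or> s = t" | "0 < t" "0 < h" "t < s"
    using assms by fastforce
  then show ?thesis
  proof cases
    case 1
    then show ?thesis using powr_add_le_add_powr[of s h r] assms by simp
  next
    case 3
    define \<mu> where "\<mu> = h / (s + h - t)"
    have \<mu>: "0 \<le> \<mu>" "\<mu> \<le> 1"
      using 3 by (simp_all add: \<mu>_def)
    have m: "\<mu> * (s + h - t) = h"
      using 3 by (simp add: \<mu>_def)
    have "(1 - \<mu>) * t + \<mu> * (s + h) = t + h" "\<mu> * t + (1 - \<mu>) * (s + h) = s"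
      using m by (simp_all add: algebra_simps)
    moreover have "((1 - \<mu>) * t + \<mu> * (s + h)) powr r \<le> (1 - \<mu>) * t powr r + \<mu> * (s + h) powr r"
      using convex_onD[OF powr_convex[OF assms(4)], of \<mu> t "s + h"] 3 \<mu> by simp
    moreover have "(\<mu> * t + (1 - \<mu>) * (s + h)) powr r \<le> \<mu> * t powr r + (1 - \<mu>) * (s + h) powr r"
      using convex_onD[OF powr_convex[OF assms(4)], of "1 - \<mu>" t "s + h"] 3 \<mu> by simp
    ultimately show ?thesis
      by (simp add: algebra_simps)
  qed auto
qed

text \<open>
  The case \<open>p \<le> q\<close> of the norm inequality for the extremal weights, those whose partial sums
  are the \<open>r\<close>-th powers of the partial sums of \<open>w\<close>. Since \<open>y\<close> decreases, \<open>y (Suc k)\<close> times the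
  partial sum of \<open>w\<close> up to \<open>k\<close> is at most the sum on the right up to \<open>k\<close>, and adding the same
  amount to the larger of two numbers increases its \<open>r\<close>-th power by more.
\<close>

lemma sum_powr_increments_le_powr_sum:
  fixes y w :: "nat \<Rightarrow> real"
  assumes y: "antimono_on {1..s} y" "\<And>j. j \<in> {1..s} \<Longrightarrow> 0 \<le> y j"
    and w: "\<And>j. 1 \<le> j \<Longrightarrow> 0 \<le> w j" and r: "1 \<le> r"
  shows "(\<Sum>j=1..s. y j powr r * ((\<Sum>i=1..j. w i) powr r - (\<Sum>i=1..j-1. w i) powr r))
           \<le> (\<Sum>j=1..s. y j * w j) powr r"
proof -
  have "k \<le> s \<longrightarrow>
    (\<Sum>j=1..k. y j powr r * ((\<Sum>i=1..j. w i) powr r - (\<Sum>i=1..j-1. w i) powr r))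
           \<le> (\<Sum>j=1..k. y j * w j) powr r" for k
  proof (induction k)
    case (Suc k)
    show ?case
    proof
      assume k: "Suc k \<le> s"
      let ?L = "\<Sum>i=1..k. w i" and ?S = "\<Sum>j=1..k. y j * w j" and ?y = "y (Suc k)"
      have "?y * ?L \<le> ?S"
        unfolding sum_distrib_left
        using k by (intro sum_mono mult_right_mono monotone_onD[OF y(1)] w) auto
      moreover have "0 \<le> ?L"
        by (intro sum_nonneg w) auto
      moreover have y0: "0 \<le> ?y"
        using y(2) k by simp
      ultimately have "(?y * ?L + ?y * w (Suc k)) powr r - (?y * ?L) powr r
          \<le> (?S + ?y * w (Suc k)) powr r - ?S powr r"
        using w[of "Suc k"] r by (intro powr_increment_mono) auto
      then have "?y powr r * ((?L + w (Suc k)) powr r - ?L powr r)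
          \<le> (?S + ?y * w (Suc k)) powr r - ?S powr r"
        by (simp add: powr_mult right_diff_distrib flip: distrib_left)
      with Suc k
      show "(\<Sum>j=1..Suc k. y j powr r * ((\<Sum>i=1..j. w i) powr r - (\<Sum>i=1..j-1. w i) powr r))
           \<le> (\<Sum>j=1..Suc k. y j * w j) powr r"
        by simp
    qed
  qed simp
  then show ?thesis by blast
qed

text \<open>
  Jensen's inequality for the concave function \<open>\<lambda>t. t powr r\<close>. With \<open>a\<close> the weighted mean of \<open>y\<close>,
  Young's inequality is the tangent line bound for this function at \<open>a\<close>, and the weighted sum of
  the tangent values at the \<open>y j\<close> is the right-hand side.
\<close>

lemma sum_powr_le_powr_sum_concave:
  fixes y u :: "nat \<Rightarrow> real"
  assumes A: "finite A" and y: "\<And>j. j \<in> A \<Longrightarrow> 0 \<le> y j" and u: "\<And>j. j \<in> A \<Longrightarrow> 0 \<le> u j"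
    and r: "0 < r" "r \<le> 1"
  shows "(\<Sum>j\<in>A. y j powr r * u j) \<le> (\<Sum>j\<in>A. y j * u j) powr r * (\<Sum>j\<in>A. u j) powr (1 - r)"
proof (cases "(\<Sum>j\<in>A. y j * u j) = 0")
  case True
  then have "\<forall>j\<in>A. y j * u j = 0"
    using A y u by (subst (asm) sum_nonneg_eq_0_iff) auto
  then have "(\<Sum>j\<in>A. y j powr r * u j) = 0"
    by (intro sum.neutral) auto
  with True show ?thesis by simp
next
  case False
  let ?Y = "\<Sum>j\<in>A. y j * u j" and ?U = "\<Sum>j\<in>A. u j"
  have Y: "0 < ?Y"
    using False y u by (simp add: less_le sum_nonneg)
  have "?U \<noteq> 0"
    using A u False by (subst sum_nonneg_eq_0_iff) (auto intro: sum.neutral)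
  then have U: "0 < ?U"
    using u by (simp add: less_le sum_nonneg)
  define a where "a = ?Y / ?U"
  have a: "0 < a" using Y U by (simp add: a_def)
  have "y j powr r * u j \<le> a powr (r - 1) * (r * (y j * u j) + (1 - r) * a * u j)" if j: "j \<in> A" for j
  proof -
    have "y j powr r * a powr (1 - r) \<le> r * y j + (1 - r) * a"
      using Youngs_inequality_0[of r "1 - r" "y j" a] r y[OF j] a
      by (cases "y j = 0") auto
    then have "a powr (r - 1) * (y j powr r * a powr (1 - r)) \<le> a powr (r - 1) * (r * y j + (1 - r) * a)"
      by (intro mult_left_mono) auto
    moreover have "a powr (r - 1) * (y j powr r * a powr (1 - r)) = y j powr r"
      using a by (simp add: mult.left_commute flip: powr_add)
    ultimately have "y j powr r * u j \<le> a powr (r - 1) * (r * y j + (1 - r) * a) * u j"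
      using u[OF j] by (intro mult_right_mono) auto
    then show ?thesis by (simp add: algebra_simps)
  qed
  then have "(\<Sum>j\<in>A. y j powr r * u j) \<le> (\<Sum>j\<in>A. a powr (r - 1) * (r * (y j * u j) + (1 - r) * a * u j))"
    by (rule sum_mono)
  also have "\<dots> = a powr (r - 1) * (r * ?Y + (1 - r) * a * ?U)"
    by (simp add: sum.distrib flip: sum_distrib_left)
  also have "r * ?Y + (1 - r) * a * ?U = ?Y"
    using U unfolding mult.assoc by (simp add: a_def algebra_simps)
  also have "a powr (r - 1) * ?Y = ?Y powr r * ?U powr (1 - r)"
    using Y U by (simp add: a_def powr_divide powr_diff field_simps)
  finally show ?thesis .
qed

text \<open>
  The hypothesis on \<open>C\<close> is the conclusion for the indicators of the initial segments \<open>{1..k}\<close>.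
  With \<open>y = x powr p\<close> and \<open>r = q / p\<close>, the hypothesis reads \<open>U k \<le> C powr q * W k powr r\<close> for the
  partial sums \<open>U\<close>, \<open>W\<close> of the weights. For \<open>r \<ge> 1\<close>, summation by parts replaces \<open>u\<close> by the weights
  with partial sums \<open>C powr q * W k powr r\<close>. For \<open>r < 1\<close>, the monotone quotient gives
  \<open>U k \<le> (U s / W s) * W k\<close>, so \<open>u\<close> can be replaced by a multiple of \<open>w\<close> before the exponent \<open>r\<close> is
  present; Jensen's inequality brings it in, at the cost of powers of \<open>U s\<close> that combine to
  the hypothesis for \<open>k = s\<close>.
\<close>

lemma weighted_norm_le_of_partial_sums_le:
  fixes x u w :: "nat \<Rightarrow> real"
  assumes x: "antimono_on {1..s} x" "\<And>j. j \<in> {1..s} \<Longrightarrow> 0 \<le> x j"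
    and u: "\<And>j. 1 \<le> j \<Longrightarrow> 0 < u j" and w: "\<And>j. 1 \<le> j \<Longrightarrow> 0 < w j"
    and p: "0 < p" and q: "0 < q" and "1 \<le> s"
    and C: "\<And>k. k \<in> {1..s} \<Longrightarrow> (\<Sum>j=1..k. u j) powr (1 / q) * (\<Sum>j=1..k. w j) powr (- 1 / p) \<le> C"
    and pq: "p \<le> q \<or> mono_on {1..} (\<lambda>k::nat. (\<Sum>j=1..k. u j) / (\<Sum>j=1..k. w j))"
  shows "(\<Sum>j=1..s. x j powr q * u j) powr (1 / q) \<le> C * (\<Sum>j=1..s. x j powr p * w j) powr (1 / p)"
proof -
  let ?U = "\<lambda>k::nat. \<Sum>j=1..k. u j" and ?W = "\<lambda>k::nat. \<Sum>j=1..k. w j"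
  define r where "r = q / p"
  define y where "y j = x j powr p" for j
  have r: "0 < r" using p q by (simp add: r_def)
  have y: "antimono_on {1..s} y" "\<And>j. j \<in> {1..s} \<Longrightarrow> 0 \<le> y j"
    using p x by (auto simp: y_def monotone_on_def intro!: powr_mono2)
  have xy: "x j powr q = y j powr r" for j
    using p by (simp add: y_def r_def powr_powr)
  have U: "0 < ?U k" and W: "0 < ?W k" if "1 \<le> k" for k
    using that u w by (auto intro!: sum_pos)
  have "0 \<le> ?U 1 powr (1 / q) * ?W 1 powr (- 1 / p)" by simp
  also have "\<dots> \<le> C" using C[of 1] \<open>1 \<le> s\<close> by simp
  finally have C0: "0 \<le> C" .
  have UW: "?U k \<le> C powr q * ?W k powr r" if k: "k \<in> {1..s}" for k
  proof -
    have "(?U k powr (1 / q) * ?W k powr (- 1 / p)) powr q \<le> C powr q"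
      using C[OF k] q by (intro powr_mono2) auto
    moreover have "(?U k powr (1 / q) * ?W k powr (- 1 / p)) powr q = ?U k * ?W k powr (- r)"
      using U[of k] W[of k] q k by (simp add: powr_mult powr_powr r_def)
    ultimately have "?U k * ?W k powr (- r) * ?W k powr r \<le> C powr q * ?W k powr r"
      by (intro mult_right_mono) auto
    then show ?thesis
      using W[of k] k by (simp add: mult.assoc flip: powr_add)
  qed
  have main: "(\<Sum>j=1..s. y j powr r * u j) \<le> C powr q * (\<Sum>j=1..s. y j * w j) powr r"
  proof (cases "p \<le> q")
    case True
    then have r1: "1 \<le> r" using p by (simp add: r_def)
    have "(\<Sum>j=1..s. y j powr r * u j)
        \<le> (\<Sum>j=1..s. y j powr r * (C powr q * (?W j powr r - ?W (j - 1) powr r)))"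
    proof (rule sum_le_sum_of_partial_sums_le)
      show "antimono_on {1..s} (\<lambda>j. y j powr r)"
        using y r by (auto simp: monotone_on_def intro!: powr_mono2)
      fix k assume k: "k \<in> {1..s}"
      have "(\<Sum>j=1..k. ?W j powr r - ?W (j - 1) powr r) = ?W k powr r"
        by (induction k) auto
      then show "?U k \<le> (\<Sum>j=1..k. C powr q * (?W j powr r - ?W (j - 1) powr r))"
        using UW[OF k] by (simp flip: sum_distrib_left)
    qed auto
    also have "\<dots> = C powr q * (\<Sum>j=1..s. y j powr r * (?W j powr r - ?W (j - 1) powr r))"
      by (simp add: sum_distrib_left mult.left_commute)
    also have "\<dots> \<le> C powr q * (\<Sum>j=1..s. y j * w j) powr r"
      using sum_powr_increments_le_powr_sum[OF y _ r1, of w] w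
      by (intro mult_left_mono) (auto simp: less_imp_le)
    finally show ?thesis .
  next
    case False
    then have r1: "r \<le> 1" using p by (simp add: r_def)
    from False pq have mono: "mono_on {1..} (\<lambda>k. ?U k / ?W k)" by simp
    define c where "c = ?U s / ?W s"
    have c: "0 < c" using U[of s] W[of s] \<open>1 \<le> s\<close> by (simp add: c_def)
    have "(\<Sum>j=1..s. y j * u j) \<le> (\<Sum>j=1..s. y j * (c * w j))"
    proof (rule sum_le_sum_of_partial_sums_le[OF y])
      fix k assume k: "k \<in> {1..s}"
      have "?U k / ?W k \<le> c"
        unfolding c_def using k by (intro mono_onD[OF mono]) auto
      then show "?U k \<le> (\<Sum>j=1..k. c * w j)"
        using W[of k] k by (simp add: divide_le_eq flip: sum_distrib_left)
    qed
    also have "\<dots> = c * (\<Sum>j=1..s. y j * w j)"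
      by (simp add: sum_distrib_left mult.left_commute)
    finally have yu: "(\<Sum>j=1..s. y j * u j) \<le> c * (\<Sum>j=1..s. y j * w j)" .
    have "(\<Sum>j=1..s. y j powr r * u j) \<le> (\<Sum>j=1..s. y j * u j) powr r * ?U s powr (1 - r)"
      using y u r r1 by (intro sum_powr_le_powr_sum_concave) (auto simp: less_imp_le)
    also have "\<dots> \<le> (c * (\<Sum>j=1..s. y j * w j)) powr r * ?U s powr (1 - r)"
      using yu r y u by (intro mult_right_mono powr_mono2 sum_nonneg) (auto simp: less_imp_le)
    also have "\<dots> = ?U s * ?W s powr (- r) * (\<Sum>j=1..s. y j * w j) powr r"
      using U[of s] W[of s] \<open>1 \<le> s\<close>
      by (simp add: c_def powr_mult powr_divide powr_diff powr_minus field_simps)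
    also have "\<dots> \<le> C powr q * (\<Sum>j=1..s. y j * w j) powr r"
    proof (rule mult_right_mono)
      have "?U s * ?W s powr (- r) \<le> C powr q * ?W s powr r * ?W s powr (- r)"
        using UW[of s] \<open>1 \<le> s\<close> by (intro mult_right_mono) auto
      then show "?U s * ?W s powr (- r) \<le> C powr q"
        using W[of s] \<open>1 \<le> s\<close> by (simp add: mult.assoc flip: powr_add)
    qed simp
    finally show ?thesis .
  qed
  \<comment> \<open>Take \<open>q\<close>-th roots: the exponent \<open>r * (1 / q)\<close> is \<open>1 / p\<close>.\<close>
  have "(\<Sum>j=1..s. x j powr q * u j) powr (1 / q) \<le> (C powr q * (\<Sum>j=1..s. y j * w j) powr r) powr (1 / q)"
    unfolding xy using main q u by (intro powr_mono2 sum_nonneg) (auto simp: less_imp_le)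
  also have "\<dots> = C * (\<Sum>j=1..s. x j powr p * w j) powr (1 / p)"
    using C0 q p by (simp add: powr_mult powr_powr r_def y_def)
  finally show ?thesis .
qed

section \<open>Nonoverlapping intervals\<close>

lemma
  assumes "is_interval (S :: real set)" "S \<noteq> {}" "S \<subseteq> {0..1}"
  shows Inf_interval_bounds: "0 \<le> Inf S" "Inf S \<le> Sup S" "Sup S \<le> 1"
    and open_subset_interior_interval: "{Inf S<..<Sup S} \<subseteq> interior S"
proof -
  have bdd: "bdd_below S" "bdd_above S"
    using assms(3) by (auto intro: bdd_below_mono bdd_above_mono)
  show "0 \<le> Inf S"
    using assms by (intro cInf_greatest) auto
  show "Sup S \<le> 1"
    using assms by (intro cSup_least) auto
  show "Inf S \<le> Sup S"
    using bdd assms(2) by (intro cInf_le_cSup)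
  have "{Inf S<..<Sup S} \<subseteq> S"
  proof
    fix x assume "x \<in> {Inf S<..<Sup S}"
    then obtain a b where "a \<in> S" "a < x" "b \<in> S" "x < b"
      using bdd assms(2) by (auto simp: cInf_less_iff less_cSup_iff)
    then show "x \<in> S"
      using assms(1) by (meson is_interval_1 less_imp_le)
  qed
  then show "{Inf S<..<Sup S} \<subseteq> interior S"
    by (rule interior_maximal) auto
qed

lemma nonoverlapping_intervals_bounds:
  assumes "nonoverlapping_intervals s I" "j \<in> {1..s}"
  shows "0 \<le> Inf (I j)" "Inf (I j) \<le> Sup (I j)" "Sup (I j) \<le> 1"
  using assms Inf_interval_bounds[of "I j"] by (auto simp: nonoverlapping_intervals_def)

lemma nonoverlapping_intervals_disjoint:
  assumes "nonoverlapping_intervals s I" "i \<in> {1..s}" "j \<in> {1..s}" "i \<noteq> j"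
  shows "{Inf (I i)<..<Sup (I i)} \<inter> {Inf (I j)<..<Sup (I j)} = {}"
  using assms open_subset_interior_interval[of "I i"] open_subset_interior_interval[of "I j"]
  unfolding nonoverlapping_intervals_def by blast

text \<open>
  Two nondegenerate intervals with a common left endpoint, or a common right endpoint, have
  common interior points. Hence a point occurs at most once among the left and at most once among
  the right endpoints, which controls how often one needle can be seen.
\<close>

lemma nonoverlapping_intervals_inj_endpoints:
  assumes "nonoverlapping_intervals s I"
  shows "inj_on (\<lambda>j. Inf (I j)) {j \<in> {1..s}. Inf (I j) < Sup (I j)}"
    and "inj_on (\<lambda>j. Sup (I j)) {j \<in> {1..s}. Inf (I j) < Sup (I j)}"
proof -
  have "False" if ij: "i \<in> {1..s}" "j \<in> {1..s}" "i \<noteq> j" "Inf (I i) < Sup (I i)" "Inf (I j) < Sup (I j)"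
    and eq: "Inf (I i) = Inf (I j) \<or> Sup (I i) = Sup (I j)" for i j
  proof -
    have "max (Inf (I i)) (Inf (I j)) < min (Sup (I i)) (Sup (I j))"
      using ij(4,5) eq by auto
    then obtain x where "max (Inf (I i)) (Inf (I j)) < x" "x < min (Sup (I i)) (Sup (I j))"
      using dense by blast
    then show False
      using nonoverlapping_intervals_disjoint[OF assms ij(1-3)] by auto
  qed
  then show "inj_on (\<lambda>j. Inf (I j)) {j \<in> {1..s}. Inf (I j) < Sup (I j)}"
    and "inj_on (\<lambda>j. Sup (I j)) {j \<in> {1..s}. Inf (I j) < Sup (I j)}"
    by (blast intro: inj_onI)+
qed

text \<open>
  The interiors are disjoint subsets of \<open>[0,1]\<close>, so the lengths add up to at most its Lebesgue
  measure.
\<close>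

lemma card_nonoverlapping_intervals_le:
  assumes I: "nonoverlapping_intervals s I" and d: "0 < d"
    and len: "\<And>j. j \<in> {1..s} \<Longrightarrow> 1 / d \<le> interval_length (I j)"
  shows "real s \<le> d"
proof -
  have "real s * (1 / d) \<le> (\<Sum>j=1..s. interval_length (I j))"
    using sum_bounded_below[of "{1..s}" "1 / d" "\<lambda>j. interval_length (I j)"] len by simp
  also have "\<dots> = (\<Sum>j=1..s. measure lborel {Inf (I j)<..<Sup (I j)})"
    using nonoverlapping_intervals_bounds[OF I]
    by (intro sum.cong) (auto simp: interval_length_def measure_lborel_Ioo)
  also have "\<dots> = measure lborel (\<Union>j\<in>{1..s}. {Inf (I j)<..<Sup (I j)})"
  proof (intro measure_finite_Union[symmetric])
    show "disjoint_family_on (\<lambda>j. {Inf (I j)<..<Sup (I j)}) {1..s}"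
      unfolding disjoint_family_on_def using nonoverlapping_intervals_disjoint[OF I] by blast
  qed (auto simp: nonoverlapping_intervals_bounds(2)[OF I])
  also have "\<dots> \<le> measure lborel {0..1::real}"
  proof (rule measure_mono_fmeasurable)
    show "(\<Union>j\<in>{1..s}. {Inf (I j)<..<Sup (I j)}) \<subseteq> {0..1}"
    proof
      fix x assume "x \<in> (\<Union>j\<in>{1..s}. {Inf (I j)<..<Sup (I j)})"
      then obtain j where "j \<in> {1..s}" "Inf (I j) < x" "x < Sup (I j)" by auto
      then show "x \<in> {0..1}"
        using nonoverlapping_intervals_bounds[OF I, of j] by simp
    qed
  qed (auto intro: fmeasurableI)
  finally show ?thesis
    using d by (simp add: field_simps)
qed

lemma nonoverlapping_intervals_reorder:
  assumes "nonoverlapping_intervals s I" "bij_betw \<pi> {1..s} {1..s}"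
  shows "nonoverlapping_intervals s (I \<circ> \<pi>)"
  using assms bij_betw_apply[OF assms(2)] bij_betw_imp_inj_on[OF assms(2)]
  unfolding nonoverlapping_intervals_def by (auto simp: inj_on_eq_iff)

section \<open>Finiteness of suprema as uniform bounds\<close>

lemma ereal_SUP_less_PInf_iff:
  "(SUP x\<in>A. ereal (F x)) < \<infinity> \<longleftrightarrow> (\<exists>V. \<forall>x\<in>A. F x \<le> V)"
proof
  assume "(SUP x\<in>A. ereal (F x)) < \<infinity>"
  then obtain n :: nat where "(SUP x\<in>A. ereal (F x)) < ereal (real n)"
    using less_PInf_Ex_of_nat by auto
  then have "ereal (F x) \<le> ereal (real n)" if "x \<in> A" for x
    using that by (meson SUP_upper less_imp_le order_trans)
  then show "\<exists>V. \<forall>x\<in>A. F x \<le> V" by auto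
next
  assume "\<exists>V. \<forall>x\<in>A. F x \<le> V"
  then obtain V where "\<forall>x\<in>A. F x \<le> V" ..
  then have "(SUP x\<in>A. ereal (F x)) \<le> ereal V"
    by (auto intro: SUP_least)
  also have "\<dots> < \<infinity>" by simp
  finally show "(SUP x\<in>A. ereal (F x)) < \<infinity>" .
qed

lemma SUP_SUP_eq_SUP_Sigma:
  fixes F :: "'a \<times> 'b \<Rightarrow> 'c::complete_lattice"
  shows "(SUP x\<in>A. SUP y\<in>B x. F (x, y)) = (SUP z\<in>Sigma A B. F z)"
proof (rule antisym)
  show "(SUP x\<in>A. SUP y\<in>B x. F (x, y)) \<le> (SUP z\<in>Sigma A B. F z)"
    by (intro SUP_least SUP_upper) auto
  show "(SUP z\<in>Sigma A B. F z) \<le> (SUP x\<in>A. SUP y\<in>B x. F (x, y))"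
  proof (rule SUP_least)
    fix z assume "z \<in> Sigma A B"
    then show "F z \<le> (SUP x\<in>A. SUP y\<in>B x. F (x, y))"
      by (intro SUP_upper2[of "fst z"] SUP_upper2[of "snd z"]) auto
  qed
qed

lemma mem_waterman_shiba_iff:
  "f \<in> waterman_shiba lam p \<longleftrightarrow>
     (\<exists>V. \<forall>s I. nonoverlapping_intervals s I \<longrightarrow>
        (\<Sum>j=1..s. \<bar>increment f (I j)\<bar> powr p / lam j) \<le> V)"
  using ereal_SUP_less_PInf_iff[of "\<lambda>(s, I). \<Sum>j=1..s. \<bar>increment f (I j)\<bar> powr p / lam j"
      "{(s, I). nonoverlapping_intervals s I}"]
  by (simp add: waterman_shiba_def case_prod_beta')

lemma mem_gamma_BV_iff:
  "f \<in> gamma_BV gam q \<delta> \<longleftrightarrow>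
     (\<exists>V. \<forall>n\<ge>1. \<forall>s I. nonoverlapping_intervals s I \<longrightarrow>
        (\<forall>j\<in>{1..s}. 1 / \<delta> n \<le> interval_length (I j)) \<longrightarrow>
        (\<Sum>j=1..s. \<bar>increment f (I j)\<bar> powr q n / gam j) powr (1 / q n) \<le> V)"
  (is "_ \<longleftrightarrow> ?R")
proof -
  let ?A = "\<lambda>n. {(s, I). nonoverlapping_intervals s I \<and> (\<forall>j\<in>{1..s}. interval_length (I j) \<ge> 1 / \<delta> n)}"
  let ?F = "\<lambda>(n, s, I). (\<Sum>j=1..s. \<bar>increment f (I j)\<bar> powr q n / gam j) powr (1 / q n)"
  have "f \<in> gamma_BV gam q \<delta> \<longleftrightarrow> (SUP n\<in>{1..}. SUP x\<in>?A n. ereal (?F (n, x))) < \<infinity>"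
    by (simp add: gamma_BV_def case_prod_beta')
  also have "(SUP n\<in>{1..}. SUP x\<in>?A n. ereal (?F (n, x))) = (SUP y\<in>Sigma {1..} ?A. ereal (?F y))"
    by (rule SUP_SUP_eq_SUP_Sigma)
  also have "\<dots> < \<infinity> \<longleftrightarrow> ?R"
    unfolding ereal_SUP_less_PInf_iff by (intro arg_cong[where f = Ex] ext) fastforce
  finally show ?thesis .
qed

text \<open>
  For each \<open>n\<close> the maximum is over finitely many \<open>k\<close>, and it is over at least \<open>k = 1\<close> because
  \<open>\<delta> n \<ge> 2\<close>. Boundedness from some index on is therefore boundedness for all \<open>n \<ge> 1\<close>.
\<close>

lemma limsup_Max_less_PInf_iff:
  fixes F :: "nat \<Rightarrow> nat \<Rightarrow> real"
  assumes d: "\<forall>n\<ge>1. 2 \<le> \<delta> n"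
  shows "limsup (\<lambda>n. ereal (Max (F n ` {k::nat. 1 \<le> k \<and> real k \<le> \<delta> n}))) < \<infinity> \<longleftrightarrow>
    (\<exists>C. \<forall>n\<ge>1. \<forall>k\<ge>1. real k \<le> \<delta> n \<longrightarrow> F n k \<le> C)"
    (is "limsup (\<lambda>n. ereal (?M n)) < \<infinity> \<longleftrightarrow> ?R")
proof -
  let ?K = "\<lambda>n. {k::nat. 1 \<le> k \<and> real k \<le> \<delta> n}"
  have "?K n \<subseteq> {..nat \<lfloor>\<delta> n\<rfloor>}" for n
    by (auto simp: le_nat_floor)
  then have fin: "finite (?K n)" for n
    by (rule finite_subset) simp
  have ne: "?K n \<noteq> {}" if "1 \<le> n" for n
  proof -
    have "2 \<le> \<delta> n" using d that by blast
    then have "1 \<in> ?K n" by simp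
    then show ?thesis by blast
  qed
  have M: "?M n \<le> C \<longleftrightarrow> (\<forall>k\<ge>1. real k \<le> \<delta> n \<longrightarrow> F n k \<le> C)" if "1 \<le> n" for n C
    using fin ne[OF that] by (subst Max_le_iff) auto
  have "limsup (\<lambda>n. ereal (?M n)) < \<infinity> \<longleftrightarrow> (\<exists>C. \<forall>n\<ge>1. ?M n \<le> C)"
  proof
    assume "limsup (\<lambda>n. ereal (?M n)) < \<infinity>"
    then obtain b :: nat where "limsup (\<lambda>n. ereal (?M n)) < ereal (real b)"
      using less_PInf_Ex_of_nat by auto
    then have "eventually (\<lambda>n. ereal (?M n) < ereal (real b)) sequentially"
      by (rule Limsup_lessD)
    then obtain N where N: "?M n < real b" if "N \<le> n" for n
      by (auto simp: eventually_sequentially)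
    have "?M n \<le> max (real b) (Max (?M ` {..N}))" for n
    proof (cases "N \<le> n")
      case False
      then have "?M n \<le> Max (?M ` {..N})"
        by (intro Max_ge) auto
      then show ?thesis by simp
    qed (use N[of n] in auto)
    then show "\<exists>C. \<forall>n\<ge>1. ?M n \<le> C" by blast
  next
    assume "\<exists>C. \<forall>n\<ge>1. ?M n \<le> C"
    then obtain C where "\<forall>n\<ge>1. ?M n \<le> C" ..
    then have "limsup (\<lambda>n. ereal (?M n)) \<le> ereal C"
      by (intro Limsup_bounded) (auto simp: eventually_sequentially)
    also have "\<dots> < \<infinity>" by simp
    finally show "limsup (\<lambda>n. ereal (?M n)) < \<infinity>" .
  qed
  then show ?thesis using M by simp
qed

section \<open>Associated functions\<close>

lemma assoc_fun_nat: "assoc_fun lam (real k) = (\<Sum>j=1..k. 1 / lam j)"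
  by (simp add: assoc_fun_def)

lemma waterman_seq_pos: "waterman_seq lam \<Longrightarrow> 1 \<le> j \<Longrightarrow> 0 < 1 / lam j"
  by (simp add: waterman_seq_def)

lemma waterman_seq_antimono: "waterman_seq lam \<Longrightarrow> antimono_on {1..} (\<lambda>j. 1 / lam j)"
  by (auto simp: waterman_seq_def monotone_on_def intro!: divide_left_mono)

lemma assoc_fun_pos: "waterman_seq lam \<Longrightarrow> 1 \<le> k \<Longrightarrow> 0 < assoc_fun lam (real k)"
  unfolding assoc_fun_nat by (intro sum_pos waterman_seq_pos) auto

lemma assoc_fun_mono:
  assumes "waterman_seq lam" "k \<le> l"
  shows "assoc_fun lam (real k) \<le> assoc_fun lam (real l)"
  unfolding assoc_fun_nat using assms waterman_seq_pos[OF assms(1)]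
  by (intro sum_mono2) (auto simp: less_imp_le)

text \<open>
  Cut \<open>{1..c * k}\<close> into \<open>c\<close> blocks of length \<open>k\<close>; as the weights decrease, the first block is the
  heaviest.
\<close>

lemma assoc_fun_mult_le:
  assumes "waterman_seq lam"
  shows "assoc_fun lam (real (c * k)) \<le> real c * assoc_fun lam (real k)"
proof (induction c)
  case (Suc c)
  have "(\<Sum>j=c*k+1..c*k+k. 1 / lam j) \<le> (\<Sum>j=1..card {c*k+1..c*k+k}. 1 / lam j)"
    by (intro sum_le_sum_initial_segment waterman_seq_antimono assms) auto
  then have "(\<Sum>j=c*k+1..c*k+k. 1 / lam j) \<le> (\<Sum>j=1..k. 1 / lam j)"
    by simp
  moreover have "(\<Sum>j=1..Suc c * k. 1 / lam j) = (\<Sum>j=1..c*k. 1 / lam j) + (\<Sum>j=c*k+1..c*k+k. 1 / lam j)"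
    using sum.ub_add_nat[of 1 "c * k" "\<lambda>j. 1 / lam j" k] by (simp add: add.commute)
  ultimately show ?case
    using Suc unfolding assoc_fun_nat by (simp add: algebra_simps)
qed (simp add: assoc_fun_def)

section \<open>A bound on the ratios implies the embedding\<close>

text \<open>
  The increments are arranged in decreasing order separately for each collection of intervals; the
  same arrangement serves both sides, since the bound \<open>V\<close> on the variation holds for every
  numbering of the intervals.
\<close>

lemma embedding_if_bounded:
  assumes lam: "waterman_seq lam" and gam: "waterman_seq gam"
    and q: "\<forall>n\<ge>1. 1 \<le> q n" and \<delta>: "\<forall>n\<ge>1. 2 \<le> \<delta> n" and p: "1 \<le> p"
    and C: "\<forall>n\<ge>1. \<forall>k\<ge>1. real k \<le> \<delta> n \<longrightarrow>
      assoc_fun gam (real k) powr (1 / q n) * assoc_fun lam (real k) powr (- 1 / p) \<le> C"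
    and alt: "(\<forall>n\<ge>1. p \<le> q n) \<or>
      mono_on {1::nat..} (\<lambda>n. assoc_fun gam (real n) / assoc_fun lam (real n))"
  shows "waterman_shiba lam p \<subseteq> gamma_BV gam q \<delta>"
proof
  fix f assume "f \<in> waterman_shiba lam p"
  then obtain V where V: "\<And>s I. nonoverlapping_intervals s I \<Longrightarrow>
      (\<Sum>j=1..s. \<bar>increment f (I j)\<bar> powr p / lam j) \<le> V"
    by (auto simp: mem_waterman_shiba_iff)
  have V0: "0 \<le> V" 
    using V[of 0 "\<lambda>_. {}"] by (simp add: nonoverlapping_intervals_def)
  have "(\<Sum>j=1..s. \<bar>increment f (I j)\<bar> powr q n / gam j) powr (1 / q n) \<le> max 0 C * V powr (1 / p)"
    if n: "1 \<le> n" and I: "nonoverlapping_intervals s I"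
      and len: "\<forall>j\<in>{1..s}. 1 / \<delta> n \<le> interval_length (I j)" for n s I
  proof (cases "s = 0")
    case False
    define a where "a j = \<bar>increment f (I j)\<bar>" for j
    have qn: "1 \<le> q n" and \<delta>n: "2 \<le> \<delta> n" using q \<delta> n by auto
    have s: "real s \<le> \<delta> n"
      using card_nonoverlapping_intervals_le[OF I, of "\<delta> n"] len \<delta>n by auto
    obtain \<pi> where \<pi>: "bij_betw \<pi> {1..s} {1..s}" "antimono_on {1..s} (a \<circ> \<pi>)"
      by (rule ex_decreasing_arrangement)
    have "antimono_on {1..s} ((\<lambda>j. a j powr q n) \<circ> \<pi>)"
      using \<pi>(2) qn by (auto simp: monotone_on_def a_def intro!: powr_mono2)
    from sum_mult_le_sum_decreasing_arrangement[OF waterman_seq_antimono[OF gam] \<pi>(1) this]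
    have "(\<Sum>j=1..s. a j powr q n * (1 / gam j)) powr (1 / q n)
        \<le> (\<Sum>j=1..s. a (\<pi> j) powr q n * (1 / gam j)) powr (1 / q n)"
      using qn waterman_seq_pos[OF gam]
      by (intro powr_mono2 sum_nonneg mult_nonneg_nonneg) (auto simp: less_imp_le)
    also have "\<dots> \<le> max 0 C * (\<Sum>j=1..s. a (\<pi> j) powr p * (1 / lam j)) powr (1 / p)"
    proof (rule weighted_norm_le_of_partial_sums_le)
      show "antimono_on {1..s} (\<lambda>j. a (\<pi> j))"
        using \<pi>(2) by (simp add: comp_def)
      show "0 < 1 / gam j" "0 < 1 / lam j" if "1 \<le> j" for j
        using that waterman_seq_pos lam gam by blast+
      show "p \<le> q n \<or> mono_on {1..} (\<lambda>k::nat. (\<Sum>j=1..k. 1 / gam j) / (\<Sum>j=1..k. 1 / lam j))"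
        using alt n unfolding assoc_fun_nat by blast
      fix k assume "k \<in> {1..s}"
      then have "1 \<le> k" "real k \<le> \<delta> n"
        using s by auto
      with C n have "assoc_fun gam (real k) powr (1 / q n) * assoc_fun lam (real k) powr (- 1 / p) \<le> C"
        by blast
      then show "(\<Sum>j=1..k. 1 / gam j) powr (1 / q n) * (\<Sum>j=1..k. 1 / lam j) powr (- 1 / p) \<le> max 0 C"
        unfolding assoc_fun_nat by simp
    qed (use False p qn in \<open>auto simp: a_def\<close>)
    also have "\<dots> \<le> max 0 C * V powr (1 / p)"
    proof (intro mult_left_mono powr_mono2)
      show "(\<Sum>j=1..s. a (\<pi> j) powr p * (1 / lam j)) \<le> V"
        using V[OF nonoverlapping_intervals_reorder[OF I \<pi>(1)]] by (simp add: a_def)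
      show "0 \<le> (\<Sum>j=1..s. a (\<pi> j) powr p * (1 / lam j))"
        using waterman_seq_pos[OF lam] by (intro sum_nonneg mult_nonneg_nonneg) (auto simp: less_imp_le)
    qed (use p in auto)
    finally show ?thesis by (simp add: a_def)
  qed (use V0 in simp)
  then show "f \<in> gamma_BV gam q \<delta>"
    unfolding mem_gamma_BV_iff by blast
qed

section \<open>Functions made of needles\<close>

text \<open>
  The function whose \<open>p\<close>-th root consists of needles. Adding up before the root is taken lets the
  point sets \<open>D k\<close> intersect: the mass at a point of \<open>D k\<close> is at least \<open>w k\<close> in any case, and the
  \<open>p\<close>-variation is bounded linearly in the masses.
\<close>

definition needle_mass :: "(nat \<Rightarrow> real set) \<Rightarrow> (nat \<Rightarrow> real) \<Rightarrow> real \<Rightarrow> real" where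
  "needle_mass D w x = (\<Sum>k. w k * indicator (D k) x)"

lemma summable_needle_mass:
  assumes "summable w" "\<And>k. 0 \<le> w k"
  shows "summable (\<lambda>k. w k * indicator (D k) x :: real)"
  by (rule summable_comparison_test'[OF assms(1), of 0]) (auto simp: assms(2) indicator_def)

lemma needle_mass_nonneg:
  assumes "summable w" "\<And>k. 0 \<le> w k"
  shows "0 \<le> needle_mass D w x"
  unfolding needle_mass_def
  by (intro suminf_nonneg summable_needle_mass) (auto simp: assms)

lemma needle_mass_ge:
  assumes "summable w" "\<And>k. 0 \<le> w k" "x \<in> D k"
  shows "w k \<le> needle_mass D w x"
  using sum_le_suminf[OF summable_needle_mass[OF assms(1,2)], of "{k}" D x] assms(2,3)
  by (simp add: needle_mass_def)

text \<open>
  Exchanging the two sums leaves, for each \<open>k\<close>, the weights at the indices \<open>j\<close> with \<open>e j \<in> D k\<close>.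
  As \<open>e\<close> is injective there are at most \<open>card (D k)\<close> of them, and their total weight is largest on
  the initial segment.
\<close>

lemma weighted_needle_mass_le:
  assumes lam: "waterman_seq lam" and J: "finite J" "J \<subseteq> {1..}" and e: "inj_on e J"
    and D: "\<And>k. finite (D k)"
    and w: "summable w" "\<And>k. 0 \<le> w k" "summable (\<lambda>k. w k * assoc_fun lam (real (card (D k))))"
  shows "(\<Sum>j\<in>J. needle_mass D w (e j) / lam j) \<le> (\<Sum>k. w k * assoc_fun lam (real (card (D k))))"
proof -
  have summable: "summable (\<lambda>k. w k * indicator (D k) (e j) / lam j)" for j
    by (rule summable_divide[OF summable_needle_mass[OF w(1,2)]])
  have "(\<Sum>j\<in>J. needle_mass D w (e j) / lam j) = (\<Sum>j\<in>J. \<Sum>k. w k * indicator (D k) (e j) / lam j)"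
    by (simp add: needle_mass_def suminf_divide summable_needle_mass[OF w(1,2)])
  also have "\<dots> = (\<Sum>k. \<Sum>j\<in>J. w k * indicator (D k) (e j) / lam j)"
    by (rule suminf_sum[symmetric]) (rule summable)
  also have "\<dots> \<le> (\<Sum>k. w k * assoc_fun lam (real (card (D k))))"
  proof (rule suminf_le)
    fix k
    let ?J = "{j \<in> J. e j \<in> D k}"
    have "e ` ?J \<subseteq> D k" by auto
    then have "card ?J \<le> card (D k)"
      using card_inj_on_le[of e ?J "D k"] e D by (auto intro: inj_on_subset)
    have "(\<Sum>j\<in>J. indicator (D k) (e j) * (1 / lam j)) = (\<Sum>j\<in>?J. 1 / lam j)"
      using J(1) by (intro sum.mono_neutral_cong_right) auto
    also have "\<dots> \<le> (\<Sum>j=1..card ?J. 1 / lam j)"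
      using J by (intro sum_le_sum_initial_segment waterman_seq_antimono lam) auto
    also have "\<dots> \<le> (\<Sum>j=1..card (D k). 1 / lam j)"
      using \<open>card ?J \<le> card (D k)\<close> waterman_seq_pos[OF lam]
      by (intro sum_mono2) (auto simp: less_imp_le)
    finally have "(\<Sum>j\<in>J. indicator (D k) (e j) * (1 / lam j)) \<le> assoc_fun lam (real (card (D k)))"
      by (simp only: assoc_fun_nat)
    then have "w k * (\<Sum>j\<in>J. indicator (D k) (e j) * (1 / lam j)) \<le> w k * assoc_fun lam (real (card (D k)))"
      using w(2) by (rule mult_left_mono)
    then show "(\<Sum>j\<in>J. w k * indicator (D k) (e j) / lam j) \<le> w k * assoc_fun lam (real (card (D k)))"
      by (simp add: sum_distrib_left)
  next
    show "summable (\<lambda>k. \<Sum>j\<in>J. w k * indicator (D k) (e j) / lam j)"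
      by (rule summable_sum) (rule summable)
  qed (rule w(3))
  finally show ?thesis .
qed

text \<open>
  The difference of two nonnegative numbers is at most the larger one, so the \<open>p\<close>-th power of an
  increment is at most the sum of the masses at the two endpoints. The left endpoints of
  nondegenerate intervals are distinct, and so are the right endpoints, and each of these two
  families contributes at most the total mass weighted by the associated function.
\<close>

lemma needle_function_in_waterman_shiba:
  assumes lam: "waterman_seq lam" and p: "1 \<le> p" and D: "\<And>k. finite (D k)"
    and w: "summable w" "\<And>k. 0 \<le> w k" "summable (\<lambda>k. w k * assoc_fun lam (real (card (D k))))"
  shows "(\<lambda>x. needle_mass D w x powr (1 / p)) \<in> waterman_shiba lam p"
proof -
  define g where "g = needle_mass D w"
  define f where "f x = g x powr (1 / p)" for x
  let ?T = "\<Sum>k. w k * assoc_fun lam (real (card (D k)))"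
  have g0: "0 \<le> g x" for x
    unfolding g_def by (rule needle_mass_nonneg[OF w(1,2)])
  have f_diff: "\<bar>f b - f a\<bar> powr p \<le> g a + g b" for a b
  proof -
    have "0 \<le> f a" "0 \<le> f b" by (simp_all add: f_def)
    then have "\<bar>f b - f a\<bar> \<le> max (f a) (f b)" by linarith
    then have "\<bar>f b - f a\<bar> powr p \<le> max (f a) (f b) powr p"
      using p by (intro powr_mono2) auto
    also have "\<dots> \<le> f a powr p + f b powr p"
      by (simp add: max_def)
    also have "\<dots> = g a + g b"
      using p g0 by (simp add: f_def powr_powr)
    finally show ?thesis .
  qed
  have "(\<Sum>j=1..s. \<bar>increment f (I j)\<bar> powr p / lam j) \<le> ?T + ?T"
    if I: "nonoverlapping_intervals s I" for s I
  proof -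
    let ?J = "{j \<in> {1..s}. Inf (I j) < Sup (I j)}"
    note inj = nonoverlapping_intervals_inj_endpoints[OF I]
    have "(\<Sum>j=1..s. \<bar>increment f (I j)\<bar> powr p / lam j) = (\<Sum>j\<in>?J. \<bar>increment f (I j)\<bar> powr p / lam j)"
    proof (rule sum.mono_neutral_right)
      show "\<forall>j\<in>{1..s} - ?J. \<bar>increment f (I j)\<bar> powr p / lam j = 0"
      proof
        fix j assume "j \<in> {1..s} - ?J"
        then have "Inf (I j) = Sup (I j)"
          using nonoverlapping_intervals_bounds(2)[OF I, of j] by auto
        then show "\<bar>increment f (I j)\<bar> powr p / lam j = 0"
          by (simp add: increment_def)
      qed
    qed auto
    also have "\<dots> \<le> (\<Sum>j\<in>?J. (g (Inf (I j)) + g (Sup (I j))) / lam j)"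
    proof (intro sum_mono divide_right_mono)
      fix j assume "j \<in> ?J"
      show "\<bar>increment f (I j)\<bar> powr p \<le> g (Inf (I j)) + g (Sup (I j))"
        unfolding increment_def by (rule f_diff)
      show "0 \<le> lam j"
        using \<open>j \<in> ?J\<close> lam by (simp add: waterman_seq_def less_imp_le)
    qed
    also have "\<dots> = (\<Sum>j\<in>?J. g (Inf (I j)) / lam j) + (\<Sum>j\<in>?J. g (Sup (I j)) / lam j)"
      by (simp add: add_divide_distrib sum.distrib)
    also have "\<dots> \<le> ?T + ?T"
      unfolding g_def
      using weighted_needle_mass_le[OF lam _ _ inj(1) D w] weighted_needle_mass_le[OF lam _ _ inj(2) D w]
      by (rule add_mono) auto
    finally show ?thesis .
  qed
  then have "f \<in> waterman_shiba lam p"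
    unfolding mem_waterman_shiba_iff by (intro exI allI impI)
  then show ?thesis by (simp add: f_def[abs_def] g_def)
qed

text \<open>
  Cut \<open>[0,1]\<close> into \<open>m\<close> equal cells, where \<open>m\<close> is about half of \<open>r k\<close>, and put a needle of mass
  \<open>1 / (2 ^ k * \<Lambda>(r k))\<close> in each cell, at distance \<open>\<theta> / m\<close> from its left end, with \<open>\<theta> < 1/2\<close>
  irrational. The interval from the needle to the right end of its cell is longer than half a
  cell, hence at least \<open>1 / d k\<close> long since \<open>2 * m \<le> d k\<close>, and it ends at a rational point, where
  the function is zero because every needle of every family is irrational.
\<close>

lemma ex_function_oscillating_at_all_scales:
  assumes lam: "waterman_seq lam" and p: "1 \<le> p"
    and r: "\<And>k. 1 \<le> r k" "\<And>k. real (r k) \<le> d k" and d: "\<And>k. 2 \<le> d k"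
  shows "\<exists>f\<in>waterman_shiba lam p. \<forall>k. \<exists>s I. nonoverlapping_intervals s I \<and> r k \<le> 3 * s \<and>
       (\<forall>j\<in>{1..s}. 1 / d k \<le> interval_length (I j) \<and>
          ((1/2) ^ k / assoc_fun lam (real (r k))) powr (1 / p) \<le> \<bar>increment f (I j)\<bar>)"
proof -
  obtain \<theta> :: real where \<theta>: "0 < \<theta>" "\<theta> < 1/2" "\<theta> \<notin> \<rat>"
  proof -
    have "\<exists>x\<in>{0<..<1/2::real}. x \<notin> \<rat>"
      by (rule real_interval_avoid_countable_set) (simp_all add: countable_rat)
    then show thesis using that by auto
  qed
  \<comment> \<open>For \<open>r k = 1\<close> a single cell fits the condition on lengths because \<open>d k\<close> is at least 2.\<close>
  define m where "m k = max 1 (r k div 2)" for k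
  \<comment> \<open>The cells are numbered from 0 here, and from 1 in the family \<open>I\<close> below.\<close>
  define D where "D k = (\<lambda>i. (real i + \<theta>) / real (m k)) ` {..<m k}" for k
  define w where "w k = (1/2) ^ k / assoc_fun lam (real (r k))" for k
  define g where "g = needle_mass D w"
  have m: "1 \<le> m k" "m k \<le> r k" "r k \<le> 3 * m k" "2 * real (m k) \<le> d k" for k
    using r[of k] d[of k] by (auto simp: m_def max_def)
  have D: "finite (D k)" "card (D k) \<le> r k" for k
    using card_image_le[of "{..<m k}" "\<lambda>i. (real i + \<theta>) / real (m k)"] m(2)[of k]
    by (auto simp: D_def)
  have L: "0 < assoc_fun lam (real (r k))" for k
    by (rule assoc_fun_pos[OF lam r(1)])
  then have w0: "0 \<le> w k" for k
    by (simp add: w_def less_imp_le)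
  have geometric: "summable (\<lambda>k. (1/2) ^ k / c)" for c :: real
    by (intro summable_divide summable_geometric) simp
  have "w k \<le> (1/2) ^ k / assoc_fun lam (real 1)" for k
    unfolding w_def using L[of k] assoc_fun_pos[OF lam, of 1] assoc_fun_mono[OF lam r(1)[of k]]
    by (intro divide_left_mono) auto
  then have sw: "summable w"
    by (intro summable_comparison_test'[OF geometric, of 0]) (simp add: w0)
  have "w k * assoc_fun lam (real (card (D k))) \<le> (1/2) ^ k / 1" for k
  proof -
    have "w k * assoc_fun lam (real (card (D k))) \<le> w k * assoc_fun lam (real (r k))"
      by (intro mult_left_mono assoc_fun_mono lam D w0)
    also have "\<dots> = (1/2) ^ k / 1"
      using L[of k] by (simp add: w_def)
    finally show ?thesis .
  qed
  moreover have "0 \<le> w k * assoc_fun lam (real (card (D k)))" for k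
    using waterman_seq_pos[OF lam] w0 unfolding assoc_fun_nat
    by (intro mult_nonneg_nonneg sum_nonneg) (auto simp: less_imp_le)
  ultimately have swL: "summable (\<lambda>k. w k * assoc_fun lam (real (card (D k))))"
    by (intro summable_comparison_test'[OF geometric[of 1], of 0]) simp
  have g_rat: "g x = 0" if "x \<in> \<rat>" for x
  proof -
    have "x \<notin> D k" for k
    proof
      assume "x \<in> D k"
      then obtain i where "x = (real i + \<theta>) / real (m k)" by (auto simp: D_def)
      then have "\<theta> = x * of_nat (m k) - of_nat i"
        using m(1)[of k] by (simp add: field_simps)
      also have "\<dots> \<in> \<rat>"
        using that by (intro Rats_diff Rats_mult Rats_of_nat)
      finally show False using \<theta>(3) by contradiction
    qed
    then show ?thesis by (simp add: g_def needle_mass_def)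
  qed
  show ?thesis
  proof (intro bexI allI)
    show "(\<lambda>x. g x powr (1 / p)) \<in> waterman_shiba lam p"
      unfolding g_def by (rule needle_function_in_waterman_shiba[OF lam p D(1) sw w0 swL])
    fix k
    have M: "0 < real (m k)" using m(1)[of k] by simp
    let ?a = "\<lambda>j::nat. (real j - 1 + \<theta>) / real (m k)" and ?b = "\<lambda>j::nat. real j / real (m k)"
    have ab: "?a j < ?b j" for j
      using M \<theta> by (simp add: divide_strict_right_mono)
    define I where "I j = {?a j..?b j}" for j
    have Inf_Sup: "Inf (I j) = ?a j" "Sup (I j) = ?b j" for j
      using ab[of j] by (simp_all add: I_def)
    have "nonoverlapping_intervals (m k) I"
      unfolding nonoverlapping_intervals_def
    proof (intro conjI ballI impI)
      fix j assume j: "j \<in> {1..m k}"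
      show "is_interval (I j)" by (simp add: I_def is_interval_cc)
      show "I j \<noteq> {}" using ab[of j] by (simp add: I_def)
      have "0 \<le> ?a j" "?b j \<le> 1" using j \<theta> M by auto
      then show "I j \<subseteq> {0..1}" by (auto simp: I_def)
    next
      have disj: "{?a i<..<?b i} \<inter> {?a j<..<?b j} = {}" if "i < j" for i j
      proof -
        have "?b i \<le> ?a j"
          using that \<theta> M by (intro divide_right_mono) auto
        then show ?thesis by auto
      qed
      fix i j :: nat assume "i \<noteq> j"
      then consider "i < j" | "j < i" by linarith
      then show "interior (I i) \<inter> interior (I j) = {}"
        unfolding I_def interior_atLeastAtMost_real using disj by cases blast+
    qed
    moreover have "1 / d k \<le> interval_length (I j) \<and>
        ((1/2) ^ k / assoc_fun lam (real (r k))) powr (1 / p) \<le> \<bar>increment (\<lambda>x. g x powr (1 / p)) (I j)\<bar>"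
      if j: "j \<in> {1..m k}" for j
    proof
      have "1 / d k \<le> 1 / (2 * real (m k))"
        using m(4)[of k] M by (intro divide_left_mono) auto
      also have "\<dots> \<le> (1 - \<theta>) / real (m k)"
        using M \<theta> by (simp add: field_simps)
      also have "\<dots> = interval_length (I j)"
        by (simp add: interval_length_def Inf_Sup diff_divide_distrib add_divide_distrib)
      finally show "1 / d k \<le> interval_length (I j)" .
      have "?a j = (real (j - 1) + \<theta>) / real (m k)" "j - 1 < m k"
        using j by (auto simp: of_nat_diff)
      then have "?a j \<in> D k" unfolding D_def by blast
      then have "w k \<le> g (?a j)"
        unfolding g_def by (rule needle_mass_ge[OF sw w0])
      then have "w k powr (1 / p) \<le> g (?a j) powr (1 / p)"
        using p w0 by (intro powr_mono2) auto
      also have "\<dots> = \<bar>increment (\<lambda>x. g x powr (1 / p)) (I j)\<bar>"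
        using g_rat[of "?b j"] p by (simp add: increment_def Inf_Sup)
      finally show "((1/2) ^ k / assoc_fun lam (real (r k))) powr (1 / p)
          \<le> \<bar>increment (\<lambda>x. g x powr (1 / p)) (I j)\<bar>"
        by (simp add: w_def)
    qed
    ultimately show "\<exists>s I. nonoverlapping_intervals s I \<and> r k \<le> 3 * s \<and>
       (\<forall>j\<in>{1..s}. 1 / d k \<le> interval_length (I j) \<and>
          ((1/2) ^ k / assoc_fun lam (real (r k))) powr (1 / p) \<le> \<bar>increment (\<lambda>x. g x powr (1 / p)) (I j)\<bar>)"
      using m(3)[of k] by blast
  qed
qed

section \<open>Unbounded ratios exclude the embedding\<close>

text \<open>
  If there is no bound, the ratio exceeds \<open>4 ^ i\<close> at some level \<open>N i\<close> and some \<open>r i\<close>.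
  At level \<open>N i\<close> the function with needles then has at least \<open>r i / 3\<close> admissible intervals with
  increments at least \<open>c\<close>, where \<open>c powr p = 1 / (2 ^ i * \<Lambda>(r i))\<close>. Because
  \<open>\<Gamma>(3 * s) \<le> 3 * \<Gamma>(s)\<close> and both exponents \<open>1 / q\<close> and \<open>1 / p\<close> are at most 1, replacing \<open>r i\<close>
  by the number of intervals costs at most a factor 3, and the power of two at most a factor
  \<open>2 ^ i\<close>. What is left of the ratio \<open>4 ^ i\<close> is \<open>2 ^ i / 3\<close>, which no variation bounds for all \<open>i\<close>.
\<close>

lemma bounded_if_embedding:
  assumes lam: "waterman_seq lam" and gam: "waterman_seq gam"
    and q: "\<forall>n\<ge>1. 1 \<le> q n" and \<delta>: "\<forall>n\<ge>1. 2 \<le> \<delta> n" and p: "1 \<le> p"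
    and emb: "waterman_shiba lam p \<subseteq> gamma_BV gam q \<delta>"
  shows "\<exists>C. \<forall>n\<ge>1. \<forall>k\<ge>1. real k \<le> \<delta> n \<longrightarrow>
      assoc_fun gam (real k) powr (1 / q n) * assoc_fun lam (real k) powr (- 1 / p) \<le> C"
proof (rule ccontr)
  let ?F = "\<lambda>n k. assoc_fun gam (real k) powr (1 / q n) * assoc_fun lam (real k) powr (- 1 / p)"
  assume "\<not> ?thesis"
  then have "\<forall>i. \<exists>n k. 1 \<le> n \<and> 1 \<le> k \<and> real k \<le> \<delta> n \<and> 4 ^ i < ?F n k" for i :: nat
    by (meson not_le)
  then obtain N r where N: "\<And>i. 1 \<le> N i" and r: "\<And>i. 1 \<le> r i" "\<And>i. real (r i) \<le> \<delta> (N i)"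
    and big: "\<And>i::nat. 4 ^ i < ?F (N i) (r i)"
    by metis
  have "2 \<le> \<delta> (N i)" for i using \<delta> N by blast
  with r have "\<exists>f\<in>waterman_shiba lam p. \<forall>i. \<exists>s I. nonoverlapping_intervals s I \<and> r i \<le> 3 * s \<and>
       (\<forall>j\<in>{1..s}. 1 / \<delta> (N i) \<le> interval_length (I j) \<and>
          ((1/2) ^ i / assoc_fun lam (real (r i))) powr (1 / p) \<le> \<bar>increment f (I j)\<bar>)"
    by (intro ex_function_oscillating_at_all_scales lam p)
  then obtain f where f: "f \<in> waterman_shiba lam p" and
    osc: "\<forall>i. \<exists>s I. nonoverlapping_intervals s I \<and> r i \<le> 3 * s \<and>
       (\<forall>j\<in>{1..s}. 1 / \<delta> (N i) \<le> interval_length (I j) \<and>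
          ((1/2) ^ i / assoc_fun lam (real (r i))) powr (1 / p) \<le> \<bar>increment f (I j)\<bar>)"
    ..
  from emb f have "f \<in> gamma_BV gam q \<delta>" ..
  then obtain V where V: "\<forall>n\<ge>1. \<forall>s I. nonoverlapping_intervals s I \<longrightarrow>
        (\<forall>j\<in>{1..s}. 1 / \<delta> n \<le> interval_length (I j)) \<longrightarrow>
        (\<Sum>j=1..s. \<bar>increment f (I j)\<bar> powr q n / gam j) powr (1 / q n) \<le> V"
    unfolding mem_gamma_BV_iff ..
  have "2 ^ i / 3 \<le> V" for i :: nat
  proof -
    obtain s I where I: "nonoverlapping_intervals s I" and s: "r i \<le> 3 * s"
      and len: "\<forall>j\<in>{1..s}. 1 / \<delta> (N i) \<le> interval_length (I j)"
      and inc: "\<And>j. j \<in> {1..s} \<Longrightarrow>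
          ((1/2) ^ i / assoc_fun lam (real (r i))) powr (1 / p) \<le> \<bar>increment f (I j)\<bar>"
      using osc by blast
    let ?q = "q (N i)" and ?G = "\<lambda>k. assoc_fun gam (real k)" and ?L = "assoc_fun lam (real (r i))"
    define c where "c = ((1/2) ^ i / ?L) powr (1 / p)"
    have q1: "1 \<le> ?q" using q N by blast
    have L: "0 < ?L" by (rule assoc_fun_pos[OF lam r(1)])
    have Gr: "0 < ?G (r i)" by (rule assoc_fun_pos[OF gam r(1)])
    have "s \<noteq> 0" using s r(1)[of i] by auto
    then have Gs: "0 < ?G s" by (intro assoc_fun_pos[OF gam]) simp
    have "?G (r i) \<le> 3 * ?G s"
      using assoc_fun_mono[OF gam s] assoc_fun_mult_le[OF gam, of 3 s] by simp
    then have "?G (r i) powr (1 / ?q) \<le> (3 * ?G s) powr (1 / ?q)"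
      using q1 Gr by (intro powr_mono2) auto
    also have "\<dots> = 3 powr (1 / ?q) * ?G s powr (1 / ?q)"
      by (rule powr_mult)
    also have "\<dots> \<le> 3 powr 1 * ?G s powr (1 / ?q)"
      using q1 by (intro mult_right_mono powr_mono) auto
    finally have G: "?G (r i) powr (1 / ?q) / 3 \<le> ?G s powr (1 / ?q)" by simp
    have "(1/2::real) ^ i = ((1/2) ^ i) powr 1" by simp
    also have "\<dots> \<le> ((1/2) ^ i) powr (1 / p)"
      using p by (intro powr_mono') (auto simp: power_le_one)
    finally have half: "(1/2::real) ^ i \<le> ((1/2) ^ i) powr (1 / p)" .
    have "c = ((1/2) ^ i) powr (1 / p) * ?L powr (- 1 / p)"
      unfolding c_def using powr_divide[of "(1/2) ^ i" ?L "1 / p"] powr_minus_divide[of ?L "1 / p"] by simp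
    with half have c: "(1/2) ^ i * ?L powr (- 1 / p) \<le> c"
      using mult_right_mono[OF half, of "?L powr (- 1 / p)"] by simp
    have "(2::real) ^ i = (1/2) ^ i * 4 ^ i"
      unfolding power_mult_distrib[symmetric] by simp
    then have "2 ^ i / 3 = (1/2) ^ i * 4 ^ i / (3::real)"
      by simp
    also have "\<dots> \<le> (1/2) ^ i * ?F (N i) (r i) / 3"
      using big[of i] by (intro divide_right_mono mult_left_mono less_imp_le) auto
    also have "\<dots> = ((1/2) ^ i * ?L powr (- 1 / p)) * (?G (r i) powr (1 / ?q) / 3)"
      by (simp only: times_divide_eq_right mult_ac)
    also have "\<dots> \<le> c * ?G s powr (1 / ?q)"
      using c G by (intro mult_mono) (auto simp: c_def)
    also have "\<dots> = (\<Sum>j=1..s. c powr ?q * (1 / gam j)) powr (1 / ?q)"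
      using q1 Gs unfolding sum_distrib_left[symmetric] assoc_fun_nat
      by (simp add: powr_mult powr_powr c_def)
    also have "\<dots> \<le> (\<Sum>j=1..s. \<bar>increment f (I j)\<bar> powr ?q / gam j) powr (1 / ?q)"
    proof (rule powr_mono2)
      show "0 \<le> (\<Sum>j=1..s. c powr ?q * (1 / gam j))"
        using waterman_seq_pos[OF gam] by (intro sum_nonneg mult_nonneg_nonneg) (auto simp: less_imp_le)
      have "c powr ?q * (1 / gam j) \<le> \<bar>increment f (I j)\<bar> powr ?q * (1 / gam j)" if "j \<in> {1..s}" for j
        using inc[OF that] that waterman_seq_pos[OF gam, of j] q1
        by (intro mult_right_mono powr_mono2) (auto simp: c_def less_imp_le)
      then show "(\<Sum>j=1..s. c powr ?q * (1 / gam j)) \<le> (\<Sum>j=1..s. \<bar>increment f (I j)\<bar> powr ?q / gam j)"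
        by (intro sum_mono) simp
    qed (use q1 in simp)
    also have "\<dots> \<le> V"
      using V N[of i] I len by blast
    finally show ?thesis .
  qed
  moreover obtain i where "3 * V < 2 ^ i"
    using real_arch_pow[of 2 "3 * V"] by auto
  ultimately show False
    by (metis divide_le_eq mult.commute not_le zero_less_numeral)
qed

theorem theorem1p4:
  fixes lam gam q \<delta> :: "nat \<Rightarrow> real" and qlim :: ereal and p :: real
  assumes "waterman_seq lam" and "waterman_seq gam"
    and "\<forall>n\<ge>1. 1 \<le> q n" and "mono_on {1..} q" and "(\<lambda>n. ereal (q n)) \<longlonglongrightarrow> qlim"
    and "\<forall>n\<ge>1. 2 \<le> \<delta> n" and "mono_on {1..} \<delta>" and "filterlim \<delta> at_top sequentially"
    and "1 \<le> p"
  shows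
    "((\<forall>n\<ge>1. p \<le> q n) \<longrightarrow>
        (waterman_shiba lam p \<subseteq> gamma_BV gam q \<delta> \<longleftrightarrow>
         limsup (\<lambda>n. ereal (Max ((\<lambda>k. assoc_fun gam (real k) powr (1 / q n)
                                     * assoc_fun lam (real k) powr (- 1 / p))
                                 ` {k::nat. 1 \<le> k \<and> real k \<le> \<delta> n}))) < \<infinity>)) \<and>
     (mono_on {1::nat..} (\<lambda>n. assoc_fun gam (real n) / assoc_fun lam (real n)) \<longrightarrow>
        (waterman_shiba lam p \<subseteq> gamma_BV gam q \<delta> \<longleftrightarrow>
         limsup (\<lambda>n. ereal (Max ((\<lambda>k. assoc_fun gam (real k) powr (1 / q n)
                                     * assoc_fun lam (real k) powr (- 1 / p))
                                 ` {k::nat. 1 \<le> k \<and> real k \<le> \<delta> n}))) < \<infinity>))"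
  unfolding limsup_Max_less_PInf_iff[OF assms(6)]
  using bounded_if_embedding[OF assms(1-3,6,9)] embedding_if_bounded[OF assms(1-3,6,9)]
  by blast

end
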